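(* Let $p$ be a prime, and let $r\in\mathbb Z$ and $a,l,n,s,t\in\mathbb N$ with $a\geqslant 2$ and $s,t<p$. Then $$\left\{\begin{matrix} pn+s\\ pr+t\end{matrix}\right\}_{l,p^{a+1}}\equiv(-1)^t\binom st\left\{\begin{matrix} n\\ r\end{matrix}\right\}_{l,p^{a}}\pmod p .$$
   Context: $\mathbb N=\{0,1,2,\ldots\}$. Binomial coefficients: $\binom x0=1$, $\binom xk=x(x-1)\cdots(x-k+1)/k!$ for $k\in\mathbb Z^+$ (for arbitrary rational $x$), and $\binom x{k}=0$ for negative integers $k$. For a prime $p$, $b\in\mathbb Z^+$, $l,n\in\mathbb N$ and $r\in\mathbb Z$, the normalized cyclotomic $\psi$-coefficient is $$\left\{\begin{matrix} n\\ r\end{matrix}\right\}_{l,p^{b}}:=p^{-\left\lfloor\frac{n-p^{b-1}-lp^{b}}{\phi(p^{b})}\right\rfloor}\sum_{k\equiv r\,(\mathrm{mod}\ p^{b})}(-1)^k\binom nk\binom{(k-r)/p^{b}}l,$$ where the sum is over all integers $k\equiv r \pmod{p^b}$ (only $0\le k\le n$ contribute), $\phi$ is Euler's totient function and $\lfloor\cdot\rfloor$ the floor function. These numbers are integers. *)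

theory Defs
  imports Complex_Main "HOL-Number_Theory.Number_Theory"
begin

text \<open>
  Meant for prime \<open>p\<close> and \<open>b \<ge> 1\<close>. The value is taken in the rationals, because the exponent in the
  normalizing factor may have either sign. All \<open>k\<close> outside \<open>{0..n}\<close> are dropped from the sum,
  as \<open>n choose k\<close> vanishes there.
\<close>

definition psi_coeff :: "nat \<Rightarrow> nat \<Rightarrow> nat \<Rightarrow> nat \<Rightarrow> int \<Rightarrow> rat" where
  "psi_coeff p b l n r =
     of_nat p powi
       (- \<lfloor>(of_nat n - of_nat (p ^ (b - 1)) - of_nat (l * p ^ b)) / (of_nat (totient (p ^ b)) :: rat)\<rfloor>) *
     (\<Sum>k | k \<le> n \<and> [int k = r] (mod int (p ^ b)).
        (- 1) ^ k * of_nat (n choose k) * ((of_int (int k - r) / of_nat (p ^ b)) gchoose l))"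

end

theory Submission
  imports Defs "HOL-Computational_Algebra.Polynomial"
begin

text \<open>
  Put \<open>q = p\<^sup>b\<close> and \<open>\<phi> = \<phi>(q)\<close>. The sum in the definition of the coefficient is a linear functional of the polynomial
  \<open>(1 - x)\<^sup>n\<close>, and multiplication of the polynomial by \<open>x\<^sup>q - 1\<close> lowers \<open>l\<close> by one. Since \<open>(1 - x)\<^sup>q\<close> equals \<open>1 - x\<^sup>q\<close> up to
  \<open>p (1 - x)^(p^(b-1)) g + p^2 h\<close>, assigning the weights \<open>\<phi>\<close> to \<open>p\<close>, \<open>1\<close> to \<open>1 - x\<close> and \<open>q\<close> to \<open>x\<^sup>q - 1\<close> gives
  the integrality of the coefficients by induction on \<open>n\<close>, for all multiples of \<open>(1 - x)\<^sup>n\<close>.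

  At level \<open>a + 1\<close>, the polynomial \<open>(1 - x)\<^sup>s (1 - x\<^sup>p)\<^sup>n\<close> yields \<open>(- 1)\<^sup>t (s choose t)\<close> times the sum for \<open>n\<close>, \<open>r\<close> at
  level \<open>a\<close>, and the exponents of the normalizing powers of \<open>p\<close> at the two levels agree. With \<open>1 - x\<^sup>p = (1 - x)\<^sup>p + p (1 - x) g\<close>
  every term but the first of the binomial expansion of \<open>(1 - x\<^sup>p)\<^sup>n\<close> has enough weight to vanish modulo \<open>p\<close> after
  normalization. The only exception is the linear term when \<open>\<phi>\<close> divides \<open>n - p^(a-1) - l p^a\<close>; then \<open>a \<ge> 2\<close> forces \<open>p\<close>
  to divide \<open>n\<close>, which supplies the missing factor.
\<close>

section \<open>Congruences for powers of \<open>1 - y\<close> in a commutative ring\<close>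

lemma add_power_second_order:
  fixes a d :: "'a :: comm_ring_1"
  shows "\<exists>v. (a + d) ^ n = a ^ n + of_nat n * a ^ (n - 1) * d + d\<^sup>2 * v"
proof (induction n)
  case 0
  show ?case by (intro exI[of _ 0]) simp
next
  case (Suc n)
  then obtain v where v: "(a + d) ^ n = a ^ n + of_nat n * a ^ (n - 1) * d + d\<^sup>2 * v" by blast
  have a: "of_nat n * (a * a ^ (n - 1)) = of_nat n * a ^ n"
    by (cases n) auto
  have "(a + d) ^ Suc n = (a + d) * (a ^ n + of_nat n * a ^ (n - 1) * d + d\<^sup>2 * v)"
    using v by simp
  also have "\<dots> = a * a ^ n + (of_nat n * (a * a ^ (n - 1))) * d + a ^ n * d
                 + d\<^sup>2 * (of_nat n * a ^ (n - 1) + a * v + d * v)"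
    by (simp add: algebra_simps power2_eq_square)
  also have "\<dots> = a ^ Suc n + of_nat (Suc n) * a ^ (Suc n - 1) * d
                 + d\<^sup>2 * (of_nat n * a ^ (n - 1) + a * v + d * v)"
    unfolding a by (simp add: algebra_simps)
  finally show ?case by blast
qed

text \<open>Expand \<open>y = 1 - u\<close> in powers of \<open>u\<close>: the inner binomial
  coefficients are multiples of \<open>p\<close> and their terms carry a factor \<open>u\<close>.
  The last term and \<open>u ^ p\<close> cancel for odd \<open>p\<close> and add up to
  \<open>2 * u ^ 2\<close> for \<open>p = 2\<close>.\<close>

lemma one_minus_power_prime:
  fixes y :: "'a :: comm_ring_1"
  assumes "prime p"
  shows "\<exists>g. 1 - y ^ p = (1 - y) ^ p + of_nat p * (1 - y) * g"
proof -
  define u where "u = 1 - y"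
  have p2: "p \<ge> 2" using assms by (simp add: prime_ge_2_nat)
  have mid: "of_nat p * u dvd of_nat (p choose k) * (- u) ^ k" if "k \<in> {1..<p}" for k
  proof -
    have "p dvd p choose k" using that assms by (intro dvd_choose_prime) auto
    then obtain c where "p choose k = p * c" by blast
    moreover have "(- u) ^ k = u * (- ((- u) ^ (k - 1)))"
      using that by (cases k) auto
    ultimately show ?thesis
      by (intro dvdI[of _ _ "of_nat c * (- ((- u) ^ (k - 1)))"]) (simp add: algebra_simps)
  qed
  have ends: "of_nat p * u dvd u ^ p + (- u) ^ p"
  proof (cases "p = 2")
    case True
    then show ?thesis by (intro dvdI[of _ _ u]) (simp add: power2_eq_square algebra_simps)
  next
    case False
    then have "odd p" using assms p2 primes_dvd_imp_eq two_is_prime_nat by blast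
    then show ?thesis by simp
  qed
  have "y ^ p = (- u + 1) ^ p" by (simp add: u_def)
  also have "\<dots> = (\<Sum>k\<le>p. of_nat (p choose k) * (- u) ^ k)"
    by (subst binomial_ring) simp
  also have "{..p} = insert 0 (insert p {1..<p})" using p2 by auto
  also have "(\<Sum>k\<in>insert 0 (insert p {1..<p}). of_nat (p choose k) * (- u) ^ k)
     = 1 + (- u) ^ p + (\<Sum>k\<in>{1..<p}. of_nat (p choose k) * (- u) ^ k)"
    using p2 by simp
  finally have "1 - y ^ p - u ^ p =
      - ((u ^ p + (- u) ^ p) + (\<Sum>k\<in>{1..<p}. of_nat (p choose k) * (- u) ^ k))"
    by simp
  moreover have "of_nat p * u dvd \<dots>"
    unfolding dvd_minus_iff by (intro dvd_add ends dvd_sum mid)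
  ultimately obtain g where "1 - y ^ p - u ^ p = of_nat p * u * g" by (auto elim: dvdE)
  then show ?thesis by (intro exI[of _ g]) (simp add: u_def algebra_simps)
qed

lemma one_minus_power_prime_power:
  fixes y :: "'a :: comm_ring_1"
  assumes "prime p"
  shows "\<exists>u. 1 - y ^ (p ^ c) = (1 - y) ^ (p ^ c) + of_nat p * u"
proof (induction c)
  case 0
  show ?case by (intro exI[of _ 0]) simp
next
  case (Suc c)
  then obtain u where u: "1 - y ^ (p ^ c) = (1 - y) ^ (p ^ c) + of_nat p * u" by blast
  obtain g where g: "1 - (y ^ (p ^ c)) ^ p =
      (1 - y ^ (p ^ c)) ^ p + of_nat p * (1 - y ^ (p ^ c)) * g"
    using one_minus_power_prime[OF assms] by blast
  obtain v where v: "((1 - y) ^ (p ^ c) + of_nat p * u) ^ p = ((1 - y) ^ (p ^ c)) ^ p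
      + of_nat p * ((1 - y) ^ (p ^ c)) ^ (p - 1) * (of_nat p * u) + (of_nat p * u)\<^sup>2 * v"
    using add_power_second_order by blast
  have "1 - y ^ (p ^ Suc c) = 1 - (y ^ (p ^ c)) ^ p"
    by (simp add: power_mult [symmetric] mult.commute)
  also have "\<dots> = (1 - y) ^ (p ^ Suc c) + of_nat p *
     (((1 - y) ^ (p ^ c)) ^ (p - 1) * (of_nat p * u) + of_nat p * u\<^sup>2 * v + (1 - y ^ (p ^ c)) * g)"
    unfolding g u[symmetric] v[unfolded u[symmetric]]
    by (simp add: power_mult [symmetric] mult.commute algebra_simps power2_eq_square)
  finally show ?case by blast
qed

text \<open>Put \<open>A = (1 - y) ^ (p ^ c)\<close>. Modulo \<open>p ^ 2\<close>,
  \<open>(1 - y ^ (p ^ c)) ^ p\<close> is \<open>A ^ p\<close>, and the linear term of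
  \<open>one_minus_power_prime\<close> at \<open>y ^ (p ^ c)\<close> keeps a factor
  \<open>A\<close>.\<close>

lemma one_minus_power_prime_power_mod_square:
  fixes y :: "'a :: comm_ring_1"
  assumes "prime p"
  shows "\<exists>g h. (1 - y) ^ (p * p ^ c) =
    1 - y ^ (p * p ^ c) + of_nat p * (1 - y) ^ (p ^ c) * g + (of_nat p)\<^sup>2 * h"
proof -
  obtain u where u: "1 - y ^ (p ^ c) = (1 - y) ^ (p ^ c) + of_nat p * u"
    using one_minus_power_prime_power[OF assms] by blast
  obtain g where g: "1 - (y ^ (p ^ c)) ^ p =
      (1 - y ^ (p ^ c)) ^ p + of_nat p * (1 - y ^ (p ^ c)) * g"
    using one_minus_power_prime[OF assms] by blast
  define A where "A = (1 - y) ^ (p ^ c)"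
  obtain v where v: "(A + of_nat p * u) ^ p = A ^ p
      + of_nat p * A ^ (p - 1) * (of_nat p * u) + (of_nat p * u)\<^sup>2 * v"
    using add_power_second_order by blast
  have "1 - (y ^ (p ^ c)) ^ p = A ^ p + of_nat p * A * g
     + (of_nat p)\<^sup>2 * (A ^ (p - 1) * u + u\<^sup>2 * v + u * g)"
    unfolding g u A_def[symmetric] v by (simp add: algebra_simps power2_eq_square)
  then have "A ^ p = 1 - (y ^ (p ^ c)) ^ p + of_nat p * A * (- g)
     + (of_nat p)\<^sup>2 * (- (A ^ (p - 1) * u + u\<^sup>2 * v + u * g))"
    by (simp add: algebra_simps)
  moreover have "A ^ p = (1 - y) ^ (p * p ^ c)" "(y ^ (p ^ c)) ^ p = y ^ (p * p ^ c)"
    by (simp_all add: A_def power_mult [symmetric] mult.commute)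
  ultimately have "(1 - y) ^ (p * p ^ c) = 1 - y ^ (p * p ^ c) + of_nat p * (1 - y) ^ (p ^ c) * (- g)
     + (of_nat p)\<^sup>2 * (- (A ^ (p - 1) * u + u\<^sup>2 * v + u * g))"
    unfolding A_def by simp
  then show ?thesis by blast
qed

section \<open>Linear functionals on integer polynomials\<close>

text \<open>The linear functional with value \<open>w k\<close> on the \<open>k\<close>-th power of
  the indeterminate.\<close>

definition lin :: "(nat \<Rightarrow> int) \<Rightarrow> int poly \<Rightarrow> int" where
  "lin w f = (\<Sum>k\<le>degree f. coeff f k * w k)"

lemma lin_eq_sum: "degree f \<le> n \<Longrightarrow> lin w f = (\<Sum>k\<le>n. coeff f k * w k)"
  unfolding lin_def by (rule sum.mono_neutral_left) (auto simp: coeff_eq_0)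

lemma lin_0 [simp]: "lin w 0 = 0"
  by (simp add: lin_def)

lemma lin_add: "lin w (f + g) = lin w f + lin w g"
proof -
  define n where "n = max (degree f) (degree g)"
  have "degree (f + g) \<le> n" "degree f \<le> n" "degree g \<le> n"
    by (auto simp: n_def degree_add_le)
  then show ?thesis by (simp add: lin_eq_sum distrib_right sum.distrib)
qed

lemma lin_smult: "lin w (smult c f) = c * lin w f"
  by (cases "c = 0") (auto simp: lin_def sum_distrib_left mult.assoc)

lemma lin_minus: "lin w (- f) = - lin w f"
  using lin_smult[of w "-1" f] by simp

lemma lin_diff: "lin w (f - g) = lin w f - lin w g"
  using lin_add[of w f "- g"] by (simp add: lin_minus)

lemma lin_sum: "lin w (\<Sum>i\<in>A. f i) = (\<Sum>i\<in>A. lin w (f i))"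
  by (induction A rule: infinite_finite_induct) (auto simp: lin_add)

lemma lin_of_nat_mult: "lin w (of_nat c * f) = int c * lin w f"
  using lin_smult[of w "int c" f] by (simp add: of_nat_poly)

lemma lin_pCons: "lin w (pCons a f) = a * w 0 + lin (\<lambda>k. w (Suc k)) f"
proof -
  have "lin w (pCons a f) = (\<Sum>k\<le>Suc (degree f). coeff (pCons a f) k * w k)"
    by (rule lin_eq_sum) (rule degree_pCons_le)
  also have "\<dots> = a * w 0 + lin (\<lambda>k. w (Suc k)) f"
    by (simp add: sum.atMost_Suc_shift lin_def del: sum.atMost_Suc)
  finally show ?thesis .
qed

lemma lin_X_power_mult: "lin w ([:0, 1:] ^ d * f) = lin (\<lambda>k. w (k + d)) f"
proof (induction d arbitrary: w)
  case (Suc d)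
  have "[:0, 1:] ^ Suc d * f = pCons 0 ([:0, 1:] ^ d * f)"
    by (simp add: mult.assoc)
  then show ?case by (simp add: lin_pCons Suc)
qed simp

lemma lin_weight_diff: "lin (\<lambda>k. v k - w k) f = lin v f - lin w f"
  by (simp add: lin_def right_diff_distrib sum_subtractf)

lemma lin_pcompose_X_power:
  "lin w (pcompose f ([:0, 1:] ^ d)) = lin (\<lambda>k. w (d * k)) f"
  by (induction f arbitrary: w)
     (auto simp: pcompose_pCons lin_add lin_pCons lin_X_power_mult add.commute)

text \<open>A detour through \<open>rat\<close>, since the sort constraint of \<open>gchoose\<close> in \<open>Complex_Main\<close> excludes \<open>int\<close>.\<close>

definition int_gbinomial :: "int \<Rightarrow> nat \<Rightarrow> int" where
  "int_gbinomial a k = \<lfloor>(of_int a :: rat) gchoose k\<rfloor>"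

lemma of_int_int_gbinomial: "(of_int (int_gbinomial a k) :: rat) = of_int a gchoose k"
  by (simp add: int_gbinomial_def flip: of_int_gbinomial)

lemma int_gbinomial_0 [simp]: "int_gbinomial a 0 = 1"
  by (simp add: int_gbinomial_def)

lemma int_gbinomial_Suc_Suc:
  "int_gbinomial (a + 1) (Suc k) = int_gbinomial a k + int_gbinomial a (Suc k)"
proof -
  have "(of_int (int_gbinomial (a + 1) (Suc k)) :: rat)
      = of_int (int_gbinomial a k + int_gbinomial a (Suc k))"
    by (simp add: of_int_int_gbinomial gbinomial_Suc_Suc)
  then show ?thesis by (simp only: of_int_eq_iff)
qed

section \<open>Weights of the psi-coefficients\<close>

text \<open>Chosen so that, for \<open>q = p ^ b\<close>, \<open>lin\<close> at
  \<open>(1 - [:0, 1:]) ^ n\<close> is the sum in \<open>psi_coeff\<close>; the \<open>div\<close>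
  is exact where it is used.\<close>

definition psi_weight :: "nat \<Rightarrow> nat \<Rightarrow> int \<Rightarrow> nat \<Rightarrow> int" where
  "psi_weight q l r k =
     (if [int k = r] (mod int q) then int_gbinomial ((int k - r) div int q) l else 0)"

lemma psi_weight_shift:
  assumes "q > 0"
  shows "psi_weight q l r (k + q) - psi_weight q l r k =
    (if l = 0 then 0 else psi_weight q (l - 1) r k)"
proof -
  have c: "[int (k + q) = r] (mod int q) \<longleftrightarrow> [int k = r] (mod int q)"
    by (simp add: cong_def)
  have d: "(int (k + q) - r) div int q = (int k - r) div int q + 1"
  proof -
    have "int (k + q) - r = (int k - r) + 1 * int q" by simp
    then show ?thesis using assms by (simp only: div_mult_self1)
  qed
  show ?thesis
    using c d by (cases l) (auto simp: psi_weight_def int_gbinomial_Suc_Suc)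
qed

text \<open>The factor acts on the weights as minus the difference with step \<open>q\<close>, which
  Pascal's rule evaluates.\<close>

lemma lin_psi_weight_mult:
  assumes "q > 0"
  shows "lin (psi_weight q l r) ((1 - [:0, 1:] ^ q) * f) =
    (if l = 0 then 0 else - lin (psi_weight q (l - 1) r) f)"
proof -
  have "lin (psi_weight q l r) ((1 - [:0, 1:] ^ q) * f) =
      - lin (\<lambda>k. psi_weight q l r (k + q) - psi_weight q l r k) f"
    unfolding lin_weight_diff by (simp add: left_diff_distrib lin_diff lin_X_power_mult)
  then show ?thesis by (simp add: psi_weight_shift[OF assms] lin_def)
qed

section \<open>Integrality\<close>

text \<open>Replace one factor \<open>(1 - y) ^ (p * P)\<close> by its three summands. The first
  costs exponent \<open>p * P\<close> but lowers \<open>l\<close>; the second costs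
  \<open>\<phi>\<close> and gives \<open>p\<close>; the third costs
  \<open>p * P \<le> 2 * \<phi>\<close> and gives \<open>p ^ 2\<close>. The arbitrary
  \<open>f\<close> absorbs \<open>g\<close> and \<open>h\<close> in the induction.\<close>

lemma prime_power_dvd_lin_psi_weight:
  assumes p: "prime p" and n: "m * (p ^ c * (p - 1)) + p ^ c + l * (p * p ^ c) \<le> n"
  shows "int p ^ m dvd lin (psi_weight (p * p ^ c) l r) ((1 - [:0, 1:]) ^ n * f)"
  using n
proof (induction n arbitrary: m l f rule: less_induct)
  case (less n)
  define P where "P = p ^ c"
  define \<phi> where "\<phi> = P * (p - 1)"
  define y :: "int poly" where "y = [:0, 1:]"
  define L where "L = lin (psi_weight (p * P) l r)"
  have p2: "p \<ge> 2" and P: "P > 0" using p by (auto simp: prime_ge_2_nat P_def prime_gt_0_nat)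
  then have pP: "p * P > 0" by simp
  have q: "p * P = \<phi> + P" using p2 by (simp add: \<phi>_def algebra_simps)
  obtain k where "p - 1 = Suc k" using p2 by (cases "p - 1") auto
  then have \<phi>: "\<phi> \<ge> P" by (simp add: \<phi>_def)
  have le: "m * \<phi> + P + l * (p * P) \<le> n" using less.prems by (simp add: P_def \<phi>_def)
  note IH = less.IH[folded P_def, folded \<phi>_def y_def]
  obtain g h where gh: "(1 - y) ^ (p * P) =
    1 - y ^ (p * P) + of_nat p * (1 - y) ^ P * g + (of_nat p)\<^sup>2 * h"
    using one_minus_power_prime_power_mod_square[OF p] unfolding P_def by blast
  show ?case
  proof (cases m)
    case 0
    then show ?thesis by simp
  next
    case (Suc m')
    then have nq: "n \<ge> p * P" and m': "m' * \<phi> + P + l * (p * P) \<le> n - \<phi>"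
      using le q by auto
    have e: "(1 - y) ^ (n - p * P) * (1 - y) ^ P = (1 - y) ^ (n - \<phi>)"
      using nq q by (simp flip: power_add)
    have d: "(1 - y) ^ n = (1 - y) ^ (n - p * P) * (1 - y) ^ (p * P)"
      using nq by (simp flip: power_add)
    have "(1 - y) ^ n * f = (1 - y ^ (p * P)) * ((1 - y) ^ (n - p * P) * f)
       + of_nat p * ((1 - y) ^ (n - \<phi>) * (g * f))
       + of_nat p * (of_nat p * ((1 - y) ^ (n - p * P) * (h * f)))"
      unfolding d gh e[symmetric] by (simp add: algebra_simps power2_eq_square)
    then have "L ((1 - y) ^ n * f) = L ((1 - y ^ (p * P)) * ((1 - y) ^ (n - p * P) * f))
       + int p * L ((1 - y) ^ (n - \<phi>) * (g * f))
       + int p * (int p * L ((1 - y) ^ (n - p * P) * (h * f)))"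
      by (simp only: L_def lin_add lin_of_nat_mult)
    moreover have "int p ^ m dvd L ((1 - y ^ (p * P)) * ((1 - y) ^ (n - p * P) * f))"
    proof (cases l)
      case 0
      then show ?thesis using p2 P by (simp add: L_def y_def lin_psi_weight_mult)
    next
      case (Suc l')
      then have "m * \<phi> + P + l' * (p * P) \<le> n - p * P" using le by simp
      moreover have "n - p * P < n" using nq pP by linarith
      ultimately have "int p ^ m dvd lin (psi_weight (p * P) l' r) ((1 - y) ^ (n - p * P) * f)"
        by (intro IH)
      then show ?thesis using Suc p2 P by (simp add: L_def y_def lin_psi_weight_mult)
    qed
    moreover have "int p ^ m dvd int p * L ((1 - y) ^ (n - \<phi>) * (g * f))"
    proof -
      have "n - \<phi> < n" using \<phi> P nq q by auto
      then have "int p ^ m' dvd L ((1 - y) ^ (n - \<phi>) * (g * f))"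
        unfolding L_def using m' by (intro IH)
      then show ?thesis using Suc by simp
    qed
    \<comment> \<open>If \<open>m' = 0\<close> then \<open>m = 1\<close>, and the explicit
      \<open>p\<close> suffices without any bound on \<open>n - p * P\<close>.\<close>
    moreover have "int p ^ m dvd int p * (int p * L ((1 - y) ^ (n - p * P) * (h * f)))"
    proof (cases m')
      case 0
      then show ?thesis using Suc by simp
    next
      case (Suc m'')
      then have "m'' * \<phi> + P + l * (p * P) \<le> n - p * P"
        using m' q \<phi> by auto
      moreover have "n - p * P < n" using nq pP by linarith
      ultimately have "int p ^ m'' dvd L ((1 - y) ^ (n - p * P) * (h * f))"
        unfolding L_def by (intro IH)
      then show ?thesis using Suc \<open>m = Suc m'\<close> by (simp add: mult_dvd_mono)
    qed
    ultimately have "int p ^ m dvd L ((1 - y) ^ n * f)" by (simp add: dvd_add)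
    then show ?thesis by (simp add: L_def y_def P_def)
  qed
qed


section \<open>Psi-coefficients as values of functionals\<close>

lemma coeff_one_minus_X_power:
  "coeff ((1 - [:0, 1:]) ^ n :: int poly) k = (- 1) ^ k * int (n choose k)"
proof -
  have X: "1 - [:0, 1:] = ([:1, - 1:] :: int poly)" by (simp add: one_pCons)
  show ?thesis
  proof (cases "k \<le> n")
    case True
    then show ?thesis by (simp add: X coeff_linear_poly_power)
  next
    case False
    then show ?thesis by (simp add: X coeff_eq_0 degree_power_eq binomial_eq_0)
  qed
qed

lemma degree_one_minus_X_power: "degree ((1 - [:0, 1:]) ^ n :: int poly) = n"
  by (simp add: one_pCons degree_power_eq)

text \<open>On the residue class of \<open>r\<close> the quotient \<open>(k - r) / p ^ b\<close> is
  an integer, so the rational sum is the image of an integer one.\<close>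

lemma psi_coeff_eq_lin:
  assumes "prime p"
  shows "psi_coeff p b l n r = of_nat p powi
       (- \<lfloor>(of_nat n - of_nat (p ^ (b - 1)) - of_nat (l * p ^ b)) / (of_nat (totient (p ^ b)) :: rat)\<rfloor>)
     * of_int (lin (psi_weight (p ^ b) l r) ((1 - [:0, 1:]) ^ n))"
proof -
  define q where "q = p ^ b"
  have q: "q > 0" using assms by (simp add: q_def prime_gt_0_nat)
  have gb: "(of_int (int k - r) / of_nat q) gchoose l = (of_int (int_gbinomial ((int k - r) div int q) l) :: rat)"
    if "[int k = r] (mod int q)" for k
  proof -
    have "int q dvd int k - r" using that by (simp add: cong_iff_dvd_diff)
    then obtain c where c: "int k - r = int q * c" by blast
    have "of_int (int k - r) / of_nat q = (of_int c :: rat)" unfolding c using q by simp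
    moreover have "(int k - r) div int q = c" unfolding c using q by simp
    ultimately show ?thesis by (simp add: of_int_int_gbinomial)
  qed
  have "of_int (lin (psi_weight q l r) ((1 - [:0, 1:]) ^ n)) =
     (\<Sum>k\<le>n. if [int k = r] (mod int q) then (- 1) ^ k * of_nat (n choose k)
        * ((of_int (int k - r) / of_nat q) gchoose l) else (0 :: rat))"
    unfolding lin_def degree_one_minus_X_power
    by (auto simp: coeff_one_minus_X_power psi_weight_def gb simp del: of_int_diff intro!: sum.cong)
  also have "\<dots> = (\<Sum>k | k \<le> n \<and> [int k = r] (mod int q). (- 1) ^ k * of_nat (n choose k)
        * ((of_int (int k - r) / of_nat q) gchoose l))"
    by (subst sum.inter_filter [symmetric]) (auto intro!: sum.cong)
  finally show ?thesis by (simp add: psi_coeff_def q_def)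
qed

section \<open>Passage from modulus \<open>q\<close> to \<open>p * q\<close>\<close>

lemma psi_weight_scale:
  assumes "p > 0" "i < p" "t < p"
  shows "psi_weight (p * q) l (int p * r + int t) (p * k + i) = (if i = t then psi_weight q l r k else 0)"
proof (cases "i = t")
  case True
  have e: "int (p * k + i) - (int p * r + int t) = int p * (int k - r)"
    using True by (simp add: algebra_simps)
  show ?thesis
    using True assms unfolding psi_weight_def cong_iff_dvd_diff e by simp
next
  case False
  have "\<not> [int (p * k + i) = int p * r + int t] (mod int (p * q))"
  proof
    assume "[int (p * k + i) = int p * r + int t] (mod int (p * q))"
    then have "[int (p * k + i) = int p * r + int t] (mod int p)"
      by (metis cong_modulus_mult of_nat_mult)
    then have "int i mod int p = int t mod int p"
      by (simp add: cong_def)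
    then show False using False assms by simp
  qed
  then show ?thesis using False by (simp add: psi_weight_def)
qed

text \<open>The composed polynomial has only exponents divisible by \<open>p\<close>, so in the
  expansion of \<open>(1 - [:0, 1:]) ^ s\<close> only the \<open>t\<close>-th power meets the
  residue class; for \<open>t > s\<close> both sides vanish.\<close>

lemma lin_psi_weight_mult_pcompose:
  assumes "p > 0" "s < p" "t < p"
  shows "lin (psi_weight (p * q) l (int p * r + int t))
      ((1 - [:0, 1:]) ^ s * pcompose f ([:0, 1:] ^ p)) =
    (- 1) ^ t * int (s choose t) * lin (psi_weight q l r) f"
proof -
  define w where "w = psi_weight (p * q) l (int p * r + int t)"
  have "(1 - [:0, 1:]) ^ s = (\<Sum>i\<le>s. smult ((- 1) ^ i * int (s choose i)) ([:0, 1:] ^ i))"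
    using poly_as_sum_of_monoms[of "(1 - [:0, 1:]) ^ s :: int poly"]
    unfolding degree_one_minus_X_power
    by (simp add: coeff_one_minus_X_power monom_altdef)
  then have "lin w ((1 - [:0, 1:]) ^ s * pcompose f ([:0, 1:] ^ p)) =
     (\<Sum>i\<le>s. (- 1) ^ i * int (s choose i) * lin (\<lambda>k. w (p * k + i)) f)"
    by (simp add: sum_distrib_right lin_sum lin_smult lin_X_power_mult lin_pcompose_X_power)
  also have "\<dots> = (\<Sum>i\<le>s. if i = t then (- 1) ^ t * int (s choose t) * lin (psi_weight q l r) f else 0)"
    using assms by (intro sum.cong) (auto simp: w_def psi_weight_scale lin_def)
  also have "\<dots> = (- 1) ^ t * int (s choose t) * lin (psi_weight q l r) f"
    by (auto simp: binomial_eq_0)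
  finally show ?thesis by (simp add: w_def)
qed

section \<open>The error term\<close>

text \<open>This is one power of \<open>p\<close> more than integrality yields. In the expansion of
  \<open>(1 - [:0, 1:] ^ p) ^ n\<close> around \<open>(1 - [:0, 1:]) ^ (p * n)\<close>, the
  \<open>j\<close>-th term gains \<open>p ^ j\<close> and loses exponent at most
  \<open>p * j\<close>.\<close>

lemma prime_power_dvd_lin_psi_weight_diff:
  assumes p: "prime p" and c: "c > 0" and s: "s < p"
    and n: "e * (p ^ c * (p - 1)) + p ^ c + l * (p * p ^ c) \<le> n"
  shows "int p ^ Suc e dvd lin (psi_weight (p * (p * p ^ c)) l r)
    ((1 - [:0, 1:]) ^ s * ((1 - [:0, 1:] ^ p) ^ n - (1 - [:0, 1:]) ^ (p * n)))"
proof -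
  define P where "P = p ^ c"
  define \<phi> where "\<phi> = P * (p - 1)"
  define x :: "int poly" where "x = 1 - [:0, 1:]"
  define L where "L = lin (psi_weight (p * (p * P)) l r)"
  have p2: "p \<ge> 2" using p by (simp add: prime_ge_2_nat)
  \<comment> \<open>\<open>c > 0\<close> enters here: \<open>p dvd P\<close> yields
    \<open>\<phi> \<ge> 2\<close> and settles the boundary case for \<open>j = 1\<close>.\<close>
  have pP: "p dvd P" "P > 0" using c p by (auto simp: P_def prime_gt_0_nat)
  then have "P \<ge> p" by (simp add: dvd_imp_le)
  moreover obtain k where "p - 1 = Suc k" using p2 by (cases "p - 1") auto
  ultimately have \<phi>2: "\<phi> \<ge> 2" using p2 by (simp add: \<phi>_def)
  have le: "e * \<phi> + P + l * (p * P) \<le> n" using n by (simp add: P_def \<phi>_def)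
  \<comment> \<open>Integrality one level up, where \<open>\<phi>\<close> and \<open>P\<close>
    become \<open>p * \<phi>\<close> and \<open>p * P\<close>.\<close>
  have wan: "int p ^ m dvd L (x ^ k * f)"
    if "m * (p * \<phi>) + p * P + l * (p * (p * P)) \<le> k" for m k f
    using prime_power_dvd_lin_psi_weight[OF p, of m "Suc c" l k r f] that
    by (simp add: L_def x_def P_def \<phi>_def mult.assoc)
  obtain g where g: "1 - [:0, 1:] ^ p = x ^ p + of_nat p * x * g"
    using one_minus_power_prime[OF p] unfolding x_def by blast
  define T where "T = (\<lambda>j. of_nat (n choose j) * (of_nat p * x * g) ^ j * (x ^ p) ^ (n - j))"
  have ple: "e * (p * \<phi>) + p * P + l * (p * (p * P)) \<le> p * n"
    using mult_le_mono2[OF le, of p] by (simp add: algebra_simps)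
  have term_dvd: "int p ^ Suc e dvd L (x ^ s * T j)" if j: "j \<in> {1..n}" for j
  proof -
    have "x ^ s * T j = of_nat ((n choose j) * p ^ j) * (x ^ (s + j + p * (n - j)) * g ^ j)"
      unfolding T_def power_mult_distrib power_mult [symmetric] power_add of_nat_mult of_nat_power
      by (simp only: mult_ac)
    then have T: "L (x ^ s * T j) = int (n choose j) * int p ^ j * L (x ^ (s + j + p * (n - j)) * g ^ j)"
      by (simp only: L_def lin_of_nat_mult) simp
    \<comment> \<open>For \<open>j > e\<close>, in particular for \<open>e = 0\<close>, the factor
      \<open>p ^ j\<close> suffices. For \<open>j = 1\<close> it matters whether the bound on
      \<open>n\<close> is attained.\<close>
    consider "j \<ge> Suc e" | "j \<ge> 2" "j \<le> e" | "j = 1" "e > 0" "e * \<phi> + P + l * (p * P) < n"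
      | "j = 1" "e > 0" "n = e * \<phi> + P + l * (p * P)"
      using j le by fastforce
    then show ?thesis
    proof cases
      case 1
      then show ?thesis unfolding T by (intro dvd_mult2 dvd_mult le_imp_power_dvd)
    next
      case 2
      define i where "i = j - 2"
      define m where "m = e - j"
      have ji: "j = i + 2" "e = m + j" using 2 by (auto simp: i_def m_def)
      \<comment> \<open>Lowering the demand from \<open>p ^ e\<close> to \<open>p ^ Suc m\<close>
        frees exponent \<open>(j - 1) * (p * \<phi>)\<close>, which covers the loss
        \<open>p * j\<close> because \<open>\<phi> \<ge> 2\<close> and
        \<open>j \<ge> 2\<close>.\<close>
      have "p * j \<le> (j - 1) * (p * \<phi>)"
      proof -
        have "p * j \<le> (j - 1) * (p * 2)" using ji by (simp add: algebra_simps)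
        also have "\<dots> \<le> (j - 1) * (p * \<phi>)" using \<phi>2 by simp
        finally show ?thesis .
      qed
      moreover have "e * (p * \<phi>) = Suc m * (p * \<phi>) + (j - 1) * (p * \<phi>)"
        using ji by (simp add: algebra_simps)
      moreover have "p * (n - j) = p * n - p * j" by (simp add: diff_mult_distrib2)
      ultimately have "Suc m * (p * \<phi>) + p * P + l * (p * (p * P)) \<le> s + j + p * (n - j)"
        using ple by linarith
      then have "int p ^ Suc m dvd L (x ^ (s + j + p * (n - j)) * g ^ j)" by (rule wan)
      then have "int p ^ j * int p ^ Suc m dvd int p ^ j * L (x ^ (s + j + p * (n - j)) * g ^ j)"
        by (rule mult_dvd_mono[OF dvd_refl])
      moreover have "int p ^ j * int p ^ Suc m = int p ^ Suc e"
        using ji by (simp add: power_add)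
      ultimately show ?thesis unfolding T by (simp only: mult.assoc dvd_mult)
    next
      case 3
      \<comment> \<open>Strictness leaves room to lose exponent \<open>p\<close> and still get the
        full \<open>p ^ e\<close>.\<close>
      have "e * \<phi> + P + l * (p * P) \<le> n - 1" using 3 by simp
      from mult_le_mono2[OF this, of p]
      have "e * (p * \<phi>) + p * P + l * (p * (p * P)) \<le> s + j + p * (n - j)"
        using 3 by (simp add: algebra_simps)
      then have "int p ^ e dvd L (x ^ (s + j + p * (n - j)) * g ^ j)" by (rule wan)
      then show ?thesis unfolding T using 3 by (simp add: mult_dvd_mono)
    next
      case 4
      \<comment> \<open>Every summand of \<open>n\<close> is a multiple of \<open>p\<close>, so
        \<open>n choose 1\<close> supplies a second \<open>p\<close> and the functional need only
        give \<open>p ^ (e - 1)\<close>.\<close>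
      have "p dvd n" using pP 4 by (simp add: \<phi>_def)
      obtain e' where e': "e = Suc e'" using 4 gr0_implies_Suc by blast
      have "p \<le> p * \<phi>" using \<phi>2 by simp
      moreover have "p * (n - j) = p * n - p" using \<open>j = 1\<close> by (simp add: diff_mult_distrib2)
      moreover have "e * (p * \<phi>) = e' * (p * \<phi>) + p * \<phi>" using e' by simp
      ultimately have "e' * (p * \<phi>) + p * P + l * (p * (p * P)) \<le> s + j + p * (n - j)"
        using ple by linarith
      then have "int p ^ e' dvd L (x ^ (s + j + p * (n - j)) * g ^ j)" by (rule wan)
      moreover have "int p * int p dvd int (n choose j) * int p ^ j"
        using \<open>p dvd n\<close> \<open>j = 1\<close> by simp
      ultimately have "int p * int p * int p ^ e' dvd L (x ^ s * T j)"
        unfolding T by (rule mult_dvd_mono [rotated])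
      then show ?thesis using e' by (simp add: mult.assoc)
    qed
  qed
  have "(1 - [:0, 1:] ^ p) ^ n = (\<Sum>j\<le>n. T j)"
    unfolding g T_def by (subst add.commute) (rule binomial_ring)
  also have "{..n} = insert 0 {1..n}" by auto
  also have "(\<Sum>j\<in>insert 0 {1..n}. T j) = x ^ (p * n) + (\<Sum>j=1..n. T j)"
    by (subst sum.insert) (auto simp: T_def power_mult)
  finally have "x ^ s * ((1 - [:0, 1:] ^ p) ^ n - x ^ (p * n)) = (\<Sum>j=1..n. x ^ s * T j)"
    by (simp add: sum_distrib_left)
  then have "L (x ^ s * ((1 - [:0, 1:] ^ p) ^ n - x ^ (p * n))) = (\<Sum>j=1..n. L (x ^ s * T j))"
    by (simp add: L_def lin_sum)
  moreover have "int p ^ Suc e dvd \<dots>" by (intro dvd_sum term_dvd)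
  ultimately show ?thesis by (simp add: L_def x_def P_def)
qed

section \<open>Comparison of the normalizing powers and conclusion\<close>

text \<open>Makes the exponents at the two levels agree: as \<open>s < p\<close>, the shift by
  \<open>s\<close> is lost in the floor.\<close>

lemma floor_scaled_div:
  fixes u :: int and d p s :: nat
  assumes "d > 0" "s < p"
  shows "(int p * u + int s) div (int p * int d) = u div int d"
proof -
  have "(int p * u + int s) div int p = u"
    using assms by simp
  then show ?thesis by (simp add: zdiv_zmult2_eq)
qed

theorem theorem1p1:
  fixes p a l n s t :: nat and r :: int
  assumes "prime p" and "a \<ge> 2" and "s < p" and "t < p"
  shows "\<exists>x y :: int.
           psi_coeff p (a + 1) l (p * n + s) (int p * r + int t) = of_int x \<and>
           psi_coeff p a l n r = of_int y \<and>
           [x = (- 1) ^ t * int (s choose t) * y] (mod int p)"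
proof -
  define c where "c = a - 1"
  have a: "a = Suc c" "c > 0" using assms(2) by (auto simp: c_def)
  define P where "P = p ^ c"
  define \<phi> where "\<phi> = P * (p - 1)"
  define u where "u = int n - int P - int (l * (p * P))"
  define e where "e = u div int \<phi>"
  define S where "S = lin (psi_weight (p * P) l r) ((1 - [:0, 1:]) ^ n)"
  define S' where "S' = lin (psi_weight (p * (p * P)) l (int p * r + int t)) ((1 - [:0, 1:]) ^ (p * n + s))"
  have p: "p \<ge> 2" "p > 0" using assms(1) by (auto simp: prime_ge_2_nat prime_gt_0_nat)
  have \<phi>: "\<phi> > 0" using p by (simp add: \<phi>_def P_def)
  have tot: "totient (p ^ a) = \<phi>" "totient (p ^ (a + 1)) = p * \<phi>"
    using assms(1) by (simp_all only: a totient_prime_power_Suc Suc_eq_plus1[symmetric])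
      (simp_all add: \<phi>_def P_def)
  have "(of_nat n - of_nat (p ^ (a - 1)) - of_nat (l * p ^ a)) / (of_nat (totient (p ^ a)) :: rat)
      = of_int u / of_int (int \<phi>)"
    by (simp add: tot) (simp add: u_def a P_def)
  then have "\<lfloor>(of_nat n - of_nat (p ^ (a - 1)) - of_nat (l * p ^ a))
        / (of_nat (totient (p ^ a)) :: rat)\<rfloor> = e"
    unfolding e_def by (simp only: floor_divide_of_int_eq)
  then have psi: "psi_coeff p a l n r = of_nat p powi (- e) * of_int S"
    using psi_coeff_eq_lin[OF assms(1), of a l n r] by (simp add: S_def a P_def)
  have "(of_nat (p * n + s) - of_nat (p ^ (a + 1 - 1)) - of_nat (l * p ^ (a + 1)))
        / (of_nat (totient (p ^ (a + 1))) :: rat)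
      = of_int (int p * u + int s) / of_int (int p * int \<phi>)"
    unfolding tot by (simp add: u_def a P_def algebra_simps)
  then have "\<lfloor>(of_nat (p * n + s) - of_nat (p ^ (a + 1 - 1)) - of_nat (l * p ^ (a + 1)))
        / (of_nat (totient (p ^ (a + 1))) :: rat)\<rfloor> = e"
    unfolding e_def floor_scaled_div[OF \<phi> assms(3), symmetric] by (simp only: floor_divide_of_int_eq)
  then have psi': "psi_coeff p (a + 1) l (p * n + s) (int p * r + int t) = of_nat p powi (- e) * of_int S'"
    using psi_coeff_eq_lin[OF assms(1), of "a + 1" l "p * n + s" "int p * r + int t"]
    by (simp add: S'_def a P_def mult.assoc)
  show ?thesis
  proof (cases "e < 0")
    \<comment> \<open>The normalizing factor is a positive power of \<open>p\<close>, so both sides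
      vanish modulo \<open>p\<close>.\<close>
    case True
    define k where "k = nat (- e)"
    have "k > 0" "- e = int k" using True by (auto simp: k_def)
    then have "int p dvd int p ^ k * z" for z by (simp add: dvd_power)
    then have "[int p ^ k * S' = (- 1) ^ t * int (s choose t) * (int p ^ k * S)] (mod int p)"
      by (simp add: cong_iff_dvd_diff)
    then show ?thesis
      using psi psi' \<open>- e = int k\<close> by (intro exI[of _ "int p ^ k * S'"] exI[of _ "int p ^ k * S"]) simp
  next
    case False
    define k where "k = nat e"
    have k: "e = int k" using False by (simp add: k_def)
    \<comment> \<open>The floor gives \<open>k * \<phi> \<le> u\<close>, which is the hypothesis of
      both divisibility lemmas.\<close>
    have "u mod int \<phi> \<ge> 0" using \<phi> by simp
    then have "int k * int \<phi> \<le> u"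
      using div_mult_mod_eq[of u "int \<phi>"] unfolding k[symmetric] e_def by linarith
    then have "int (k * \<phi> + P + l * (p * P)) \<le> int n" by (simp add: u_def)
    then have le: "k * \<phi> + P + l * (p * P) \<le> n" by (simp only: of_nat_le_iff)
    have "int p ^ k dvd S"
      using prime_power_dvd_lin_psi_weight[OF assms(1), of k c l n r 1] le
      by (simp add: S_def P_def \<phi>_def)
    then obtain y where y: "S = int p ^ k * y" by blast
    have "pcompose ((1 - [:0, 1:]) ^ n) ([:0, 1:] ^ p) = (1 - [:0, 1:] ^ p :: int poly) ^ n"
      by (induction n) (simp_all add: pcompose_mult pcompose_diff pcompose_pCons pcompose_1)
    then have S: "(- 1) ^ t * int (s choose t) * S = lin (psi_weight (p * (p * P)) l (int p * r + int t))
        ((1 - [:0, 1:]) ^ s * (1 - [:0, 1:] ^ p) ^ n)"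
      unfolding S_def using lin_psi_weight_mult_pcompose[OF p(2) assms(3,4)] by metis
    have "(- 1) ^ t * int (s choose t) * S - S' = lin (psi_weight (p * (p * P)) l (int p * r + int t))
        ((1 - [:0, 1:]) ^ s * ((1 - [:0, 1:] ^ p) ^ n - (1 - [:0, 1:]) ^ (p * n)))"
      unfolding S S'_def right_diff_distrib lin_diff by (simp add: power_add mult.commute)
    then have d: "int p ^ Suc k dvd (- 1) ^ t * int (s choose t) * S - S'"
      using prime_power_dvd_lin_psi_weight_diff[OF assms(1) a(2) assms(3)] le
      by (simp add: P_def \<phi>_def)
    then have "int p ^ k dvd (- 1) ^ t * int (s choose t) * S - S'"
      by (rule dvd_trans[rotated]) simp
    then have "int p ^ k dvd S'"
      using y by (metis dvd_diff_right_iff dvd_mult dvd_triv_left)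
    then obtain x where x: "S' = int p ^ k * x" by blast
    \<comment> \<open>Cancelling \<open>p ^ k\<close> leaves the surplus factor \<open>p\<close> of
      the error term as the modulus.\<close>
    have "int p ^ k * int p dvd int p ^ k * ((- 1) ^ t * int (s choose t) * y - x)"
      using d unfolding x y by (simp add: algebra_simps)
    then have "int p dvd (- 1) ^ t * int (s choose t) * y - x" using p by simp
    then have "[x = (- 1) ^ t * int (s choose t) * y] (mod int p)"
      by (metis cong_iff_dvd_diff cong_sym)
    moreover have "of_nat p powi (- e) * of_int (int p ^ k * z) = (of_int z :: rat)" for z
      using p by (simp add: k power_int_minus)
    ultimately show ?thesis unfolding psi psi' x y by blast
  qed
qed

end
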